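(* Let $\phi:\mathbb R\to[0,+\infty]$ be an Orlicz function. The following conditions are equivalent: 1) $ces_\phi\neq\{0\}$; 2) there exists $n_1\in\mathbb N$ such that $\sum_{n=n_1}^{\infty}\phi\left(\frac1n\right)<\infty$; 3) for every $k>0$ there exists $n_k\in\mathbb N$ such that $\sum_{n=n_k}^{\infty}\phi\left(\frac kn\right)<\infty$.
   Context: A map $\phi:\mathbb R\to[0,+\infty]$ is an Orlicz function if it is even, convex, left continuous on $\mathbb R_+=[0,\infty)$, continuous at zero, $\phi(0)=0$ and $\phi(u)\to\infty$ as $u\to\infty$ (the value $+\infty$ is allowed). Let $l^0$ be the space of all real sequences $x=(x(i))_{i=1}^\infty$. For $x\in l^0$ put $\sigma x(i)=\frac1i\sum_{j=1}^i|x(j)|$ and $\rho_\phi(x)=\sum_{i=1}^\infty\phi(\sigma x(i))$. The Cesàro–Orlicz sequence space is $ces_\phi=\{x\in l^0:\ \rho_\phi(\lambda x)<\infty\text{ for some }\lambda>0\}$. *)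

theory Defs
  imports "HOL-Analysis.Analysis"
begin

(* The library predicate convex_on only covers real-valued functions, so convexity of a
   [0,\<infinity>]-valued function is written out; in ennreal, 0 * \<infinity> = 0. *)
definition orlicz_function :: "(real \<Rightarrow> ennreal) \<Rightarrow> bool" where
  "orlicz_function \<phi> \<longleftrightarrow>
     (\<forall>u. \<phi> (- u) = \<phi> u) \<and>
     (\<forall>u v t. 0 \<le> t \<longrightarrow> t \<le> 1 \<longrightarrow>
        \<phi> ((1 - t) * u + t * v) \<le> ennreal (1 - t) * \<phi> u + ennreal t * \<phi> v) \<and>
     (\<forall>u\<ge>0. continuous (at_left u) \<phi>) \<and>
     isCont \<phi> 0 \<and>
     \<phi> 0 = 0 \<and>
     (\<phi> \<longlongrightarrow> \<infinity>) at_top"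

(* Sequences are functions on nat with the index shifted by one: the term x(i), i \<ge> 1,
   is represented by x (i - 1).  Hence cesaro_mean x i is the average over the first
   i + 1 terms. *)
definition cesaro_mean :: "(nat \<Rightarrow> real) \<Rightarrow> nat \<Rightarrow> real" where
  "cesaro_mean x i = (1 / real (Suc i)) * (\<Sum>j\<le>i. \<bar>x j\<bar>)"

definition ces_modular :: "(real \<Rightarrow> ennreal) \<Rightarrow> (nat \<Rightarrow> real) \<Rightarrow> ennreal" where
  "ces_modular \<phi> x = (\<Sum>i. \<phi> (cesaro_mean x i))"

definition ces :: "(real \<Rightarrow> ennreal) \<Rightarrow> (nat \<Rightarrow> real) set" where
  "ces \<phi> = {x. \<exists>c>0. ces_modular \<phi> (\<lambda>i. c * x i) < \<infinity>}"

end

theory Submission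
  imports Defs
begin

(* The sequence (a,0,0,...) has Cesaro means a/n, and the means of any sequence with a
   nonzero entry dominate a/n eventually for some a > 0.  So everything reduces to showing
   that convergence of the tails of sum phi(a/n) does not depend on a > 0.  For an integer
   K \<ge> k/a, monotonicity gives phi(k/n) \<le> phi(a/(n div K)), and each value of n div K is
   taken K times. *)

text \<open>Convexity on the segment from 0 to \<open>v\<close>, together with
  \<open>\<phi> 0 = 0\<close>, gives \<open>\<phi> u \<le> t * \<phi> v\<close> for
  \<open>t = u / v \<le> 1\<close>.\<close>

lemma orlicz_mono:
  assumes "orlicz_function \<phi>" "0 \<le> u" "u \<le> v"
  shows "\<phi> u \<le> \<phi> v"
proof (cases "v = 0")
  case True
  with assms show ?thesis by simp
next
  case False
  define t where "t = u / v"
  have t: "0 \<le> t" "t \<le> 1" "t * v = u"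
    using False assms by (auto simp: t_def)
  have "\<phi> ((1 - t) * 0 + t * v) \<le> ennreal (1 - t) * \<phi> 0 + ennreal t * \<phi> v"
    using assms(1) t unfolding orlicz_function_def by blast
  moreover have "\<phi> 0 = 0"
    using assms(1) by (simp add: orlicz_function_def)
  ultimately have "\<phi> u \<le> ennreal t * \<phi> v"
    using t by simp
  also have "\<dots> \<le> 1 * \<phi> v"
    using t by (intro mult_right_mono) auto
  finally show ?thesis by simp
qed

lemma suminf_shift_le:
  fixes f :: "nat \<Rightarrow> ennreal"
  shows "(\<Sum>m. f (m + N)) \<le> (\<Sum>m. f m)"
  using suminf_offset[of f N] by (simp add: add.commute)

lemma suminf_div_le:
  fixes f :: "nat \<Rightarrow> ennreal"
  assumes "K > 0"
  shows "(\<Sum>m. f (m div K)) \<le> of_nat K * (\<Sum>m. f m)"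
proof (rule suminf_le_const)
  fix n
  \<comment> \<open>Lengthening the partial sum to \<open>n * K\<close> terms makes it a union of
    \<open>n\<close> complete blocks of length \<open>K\<close>, on each of which
    \<open>m div K\<close> is constant.\<close>
  have "(\<Sum>m<n. f (m div K)) \<le> (\<Sum>m<n * K. f (m div K))"
    using assms by (intro sum_mono2) auto
  also have "\<dots> = (\<Sum>q<n. \<Sum>m=q * K..<q * K + K. f (m div K))"
    by (rule sum.nat_group[symmetric])
  also have "\<dots> = (\<Sum>q<n. of_nat K * f q)"
  proof (rule sum.cong)
    fix q
    have "m div K = q" if "m \<in> {q * K..<q * K + K}" for m
      using that by (intro div_nat_eqI) (auto simp: mult.commute)
    then show "(\<Sum>m=q * K..<q * K + K. f (m div K)) = of_nat K * f q"
      by simp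
  qed simp
  also have "\<dots> \<le> of_nat K * (\<Sum>m. f m)"
    unfolding sum_distrib_left[symmetric] by (intro mult_left_mono sum_le_suminf) auto
  finally show "(\<Sum>m<n. f (m div K)) \<le> of_nat K * (\<Sum>m. f m)" .
qed simp

lemma orlicz_tail_rescale:
  fixes a k :: real
  assumes "orlicz_function \<phi>" "a > 0" "k > 0" "N \<ge> 1"
    and fin: "(\<Sum>m. \<phi> (a / real (N + m))) < \<infinity>"
  shows "\<exists>n\<ge>1. (\<Sum>m. \<phi> (k / real (n + m))) < \<infinity>"
proof -
  obtain K :: nat where K: "k / a < real K"
    using reals_Archimedean2 by blast
  moreover have "0 < k / a"
    using assms by simp
  ultimately have "K > 0"
    by (metis gr0I less_asym of_nat_0)
  \<comment> \<open>Starting at the multiple \<open>K * N\<close> makes the quotient of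
    \<open>K * N + m\<close> by \<open>K\<close> equal to \<open>N + m div K\<close>, so the
    comparison series begins exactly at \<open>N\<close>. Rounding down gives
    \<open>K * (N + m div K) \<le> K * N + m\<close>, and \<open>k < a * K\<close> does the
    rest.\<close>
  have bound: "\<phi> (k / real (K * N + m)) \<le> \<phi> (a / real (N + m div K))" for m
  proof (rule orlicz_mono[OF assms(1)])
    have "K * (N + m div K) \<le> K * N + m"
      by (simp add: distrib_left)
    then have "real K * real (N + m div K) \<le> real (K * N + m)"
      by (metis of_nat_le_iff of_nat_mult)
    then have "a * (real K * real (N + m div K)) \<le> a * real (K * N + m)"
      using assms(2) by simp
    moreover have "k * real (N + m div K) \<le> a * real K * real (N + m div K)"
      using K assms(2) by (intro mult_right_mono) (auto simp: field_simps)
    ultimately have "k * real (N + m div K) \<le> a * real (K * N + m)"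
      by (simp only: mult.assoc)
    then show "k / real (K * N + m) \<le> a / real (N + m div K)"
      using \<open>K > 0\<close> \<open>N \<ge> 1\<close> by (subst frac_le_eq) (auto simp: divide_le_0_iff simp del: of_nat_add of_nat_mult)
  qed (use assms in simp)
  have "(\<Sum>m. \<phi> (k / real (K * N + m))) \<le> (\<Sum>m. \<phi> (a / real (N + m div K)))"
    by (intro suminf_le bound) auto
  also have "\<dots> \<le> of_nat K * (\<Sum>m. \<phi> (a / real (N + m)))"
    by (rule suminf_div_le[OF \<open>K > 0\<close>])
  also have "\<dots> < \<infinity>"
    using fin by (simp add: ennreal_mult_less_top of_nat_less_top)
  finally show ?thesis
    using \<open>K > 0\<close> \<open>N \<ge> 1\<close> by (intro exI[of _ "K * N"]) (auto simp: Suc_le_eq)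
qed

text \<open>Ensures that \<open>ces \<phi> \<noteq> {\<lambda>i. 0}\<close> yields a nonzero member,
  since it excludes the case of an empty \<open>ces \<phi>\<close>.\<close>

lemma zero_in_ces:
  assumes "orlicz_function \<phi>"
  shows "(\<lambda>i. 0) \<in> ces \<phi>"
proof -
  have "\<phi> 0 = 0"
    using assms by (simp add: orlicz_function_def)
  then have "ces_modular \<phi> (\<lambda>i. 1 * 0) < \<infinity>"
    by (simp add: ces_modular_def cesaro_mean_def)
  then show ?thesis
    unfolding ces_def using zero_less_one by blast
qed

text \<open>From index \<open>j\<close> on, the sum inside the Cesaro mean contains the summand
  \<open>\<bar>c * x j\<bar>\<close>, which serves as \<open>a\<close>. The mean at index
  \<open>m + j\<close> has divisor \<open>Suc j + m\<close>, hence the start of the tail.\<close>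

lemma ces_nontrivial_imp_tail:
  assumes "orlicz_function \<phi>" "x \<in> ces \<phi>" "x j \<noteq> 0"
  shows "\<exists>a>0. (\<Sum>m. \<phi> (a / real (Suc j + m))) < \<infinity>"
proof -
  obtain c where "c > 0" and fin: "ces_modular \<phi> (\<lambda>i. c * x i) < \<infinity>"
    using assms(2) by (auto simp: ces_def)
  define a where "a = \<bar>c * x j\<bar>"
  have "a > 0"
    using \<open>c > 0\<close> assms(3) by (simp add: a_def)
  have "\<phi> (a / real (Suc j + m)) \<le> \<phi> (cesaro_mean (\<lambda>i. c * x i) (m + j))" for m
  proof (rule orlicz_mono[OF assms(1)])
    have "a \<le> (\<Sum>i\<le>m + j. \<bar>c * x i\<bar>)"
      unfolding a_def by (rule member_le_sum) auto
    then show "a / real (Suc j + m) \<le> cesaro_mean (\<lambda>i. c * x i) (m + j)"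
      unfolding cesaro_mean_def by (simp add: divide_right_mono add_ac)
  qed (use \<open>a > 0\<close> in simp)
  then have "(\<Sum>m. \<phi> (a / real (Suc j + m)))
      \<le> (\<Sum>m. \<phi> (cesaro_mean (\<lambda>i. c * x i) (m + j)))"
    by (intro suminf_le) auto
  also have "\<dots> \<le> ces_modular \<phi> (\<lambda>i. c * x i)"
    unfolding ces_modular_def by (rule suminf_shift_le)
  finally show ?thesis
    using fin \<open>a > 0\<close> by (auto intro: le_less_trans)
qed

text \<open>Since \<open>\<phi>\<close> may take the value \<open>\<infinity>\<close>, finiteness of
  the tail does not control the terms before it. Scaling by \<open>1 / N\<close> moves all arguments
  into the interval from 0 to \<open>1 / N\<close>, where \<open>\<phi>\<close> is finite because
  \<open>\<phi> (1 / N)\<close> is a term of the convergent series.\<close>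

lemma tail_imp_unit_in_ces:
  assumes "orlicz_function \<phi>" "N \<ge> 1" and fin: "(\<Sum>m. \<phi> (1 / real (N + m))) < \<infinity>"
  shows "(\<lambda>i. if i = 0 then 1 else 0) \<in> ces \<phi>"
proof -
  define c where "c = 1 / real N"
  have c: "0 < c" "c \<le> 1"
    using assms(2) by (auto simp: c_def)
  have mean: "cesaro_mean (\<lambda>i. c * (if i = 0 then 1 else 0)) i = c / real (Suc i)" for i
  proof -
    have "(\<Sum>j\<le>i. \<bar>c * (if j = 0 then 1 else 0)\<bar>) = (\<Sum>j\<le>i. if j = 0 then c else 0)"
      using c by (intro sum.cong) auto
    then show ?thesis
      by (simp add: cesaro_mean_def)
  qed
  have head: "\<phi> (c / real (Suc i)) < \<infinity>" for i
  proof -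
    have "\<phi> (c / real (Suc i)) \<le> \<phi> (1 / real (N + 0))"
      using c by (intro orlicz_mono[OF assms(1)]) (auto simp: c_def[symmetric] divide_le_eq)
    also have "\<dots> \<le> (\<Sum>m. \<phi> (1 / real (N + m)))"
      using sum_le_suminf[of "\<lambda>m. \<phi> (1 / real (N + m))" "{0}"] by simp
    finally show ?thesis
      using fin by (rule le_less_trans)
  qed
  have "(\<Sum>i. \<phi> (c / real (Suc i)))
      = (\<Sum>m. \<phi> (c / real (Suc (m + N)))) + (\<Sum>i<N. \<phi> (c / real (Suc i)))"
    by (rule suminf_offset) simp
  \<comment> \<open>The divisors differ by one, but the comparison is termwise:
    \<open>c \<le> 1\<close> and \<open>N + m \<le> Suc (m + N)\<close>.\<close>
  moreover have "(\<Sum>m. \<phi> (c / real (Suc (m + N)))) \<le> (\<Sum>m. \<phi> (1 / real (N + m)))"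
    using c assms(2) by (intro suminf_le orlicz_mono[OF assms(1)] frac_le) auto
  moreover have "(\<Sum>i<N. \<phi> (c / real (Suc i))) < \<infinity>"
    using head by simp
  ultimately have "(\<Sum>i. \<phi> (c / real (Suc i))) < \<infinity>"
    using fin by (simp add: less_top[symmetric] neq_top_trans)
  then have "ces_modular \<phi> (\<lambda>i. c * (if i = 0 then 1 else 0)) < \<infinity>"
    unfolding ces_modular_def mean .
  then show ?thesis
    using c(1) unfolding ces_def by blast
qed

theorem theorem2p1:
  fixes \<phi> :: "real \<Rightarrow> ennreal"
  assumes "orlicz_function \<phi>"
  shows "(ces \<phi> \<noteq> {\<lambda>i. 0} \<longleftrightarrow>
            (\<exists>n\<^sub>1\<ge>1. (\<Sum>m. \<phi> (1 / real (n\<^sub>1 + m))) < \<infinity>)) \<and>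
         ((\<exists>n\<^sub>1\<ge>1. (\<Sum>m. \<phi> (1 / real (n\<^sub>1 + m))) < \<infinity>) \<longleftrightarrow>
            (\<forall>k::real. k > 0 \<longrightarrow> (\<exists>n\<^sub>k\<ge>1. (\<Sum>m. \<phi> (k / real (n\<^sub>k + m))) < \<infinity>)))"
    (is "(?A \<longleftrightarrow> ?B) \<and> (?B \<longleftrightarrow> ?C)")
proof -
  have ?B if nontrivial: ?A
  proof -
    obtain x where "x \<in> ces \<phi>" "x \<noteq> (\<lambda>i. 0)"
      using nontrivial zero_in_ces[OF assms] by blast
    then obtain j where "x j \<noteq> 0"
      by auto
    from ces_nontrivial_imp_tail[OF assms \<open>x \<in> ces \<phi>\<close> this]
    obtain a where a: "a > 0" "(\<Sum>m. \<phi> (a / real (Suc j + m))) < \<infinity>"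
      by blast
    \<comment> \<open>The tail obtained for \<open>a\<close> is rescaled to
      \<open>k = 1\<close>.\<close>
    show ?B
      by (rule orlicz_tail_rescale[OF assms a(1) _ _ a(2)]) simp_all
  qed
  moreover have ?A if ?B
  proof -
    have "(\<lambda>i. if i = 0 then 1 else 0 :: real) \<in> ces \<phi>"
      using that tail_imp_unit_in_ces[OF assms] by blast
    moreover have "(\<lambda>i::nat. if i = 0 then 1 else 0 :: real) \<noteq> (\<lambda>i. 0)"
      by (auto simp: fun_eq_iff)
    ultimately show ?A
      by (metis singletonD)
  qed
  moreover have ?C if ?B
    using that orlicz_tail_rescale[OF assms, of 1] by (metis zero_less_one)
  moreover have ?B if ?C
    using that by simp
  ultimately show ?thesis
    by blast
qed

end
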